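(* Let $k$ be a field and let $A=k1_A+\mathfrak{m}$ be a (nonzero) summability algebra over $k$ that has evaluations, with $\mathfrak m$ the corresponding closed ideal. Then $A$ is a local algebra with maximal ideal $\mathfrak{m}$.
   Context: Vector spaces and algebras are over $k$; algebras are associative, not necessarily commutative. $V^I$ is the space of maps $I\to V$, $V^{(I)}$ the subspace of maps with finite support. Summability spaces. A summability structure $\Sigma$ on a vector space $V$ consists, for every set $I$, of a linear subspace $\mathrm{dom}\,\Sigma_I\subseteq V^I$ (the summable families) and a linear map $\Sigma_I\colon \mathrm{dom}\,\Sigma_I\to V$ (also written $\sum_{i\in I}\mathbf{v}(i)$), such that for all sets $I,J$: (SS1) $V^{(I)}\subseteq \mathrm{dom}\,\Sigma_I$ and $\Sigma_I\mathbf{v}$ is the usual finite sum for $\mathbf{v}\in V^{(I)}$; (SS2) if $\varphi\colon I\to J$ is bijective and $\mathbf{v}\in\mathrm{dom}\,\Sigma_J$, then $\mathbf{v}\circ\varphi\in\mathrm{dom}\,\Sigma_I$ and $\Sigma_I(\mathbf{v}\circ\varphi)=\Sigma_J\mathbf{v}$; (SS3) if $I=\bigsqcup_{j\in J}I_j$ and $\mathbf{v}\in\mathrm{dom}\,\Sigma_I$, then $\mathbf{v}|_{I_j}\in\mathrm{dom}\,\Sigma_{I_j}$ for all $j$, $(\Sigma_{I_j}\mathbf{v}|_{I_j})_{j\in J}\in\mathrm{dom}\,\Sigma_J$ and $\Sigma_I\mathbf{v}=\Sigma_J\big((\Sigma_{I_j}\mathbf{v}|_{I_j})_{j\in J}\big)$;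 (SS4) if $I=I_1\sqcup I_2$, $\mathbf{v}\in\mathrm{dom}\,\Sigma_{I_1}$, $\mathbf{w}\in\mathrm{dom}\,\Sigma_{I_2}$, then the family on $I$ restricting to $\mathbf{v}$ on $I_1$ and to $\mathbf{w}$ on $I_2$ lies in $\mathrm{dom}\,\Sigma_I$. $(V,\Sigma)$ is ultrafinite if moreover (UF): for every $\mathbf{v}\in\mathrm{dom}\,\Sigma_I$ and every family $(f_i\colon X_i\to k)_{i\in I}$ with each $X_i$ finite, the family $(f_i(x)\mathbf{v}(i))_{i\in I,\,x\in X_i}$ is summable. A subspace $W$ is closed if sums of summable families of elements of $W$ lie in $W$. A closed ideal is a two-sided ideal that is a closed subspace. A summability algebra is an algebra $A$ with a summability structure such that for $\mathbf{a}\in\mathrm{dom}\,\Sigma_I$, $\mathbf{b}\in\mathrm{dom}\,\Sigma_J$ the family $(\mathbf{a}(i)\cdot\mathbf{b}(j))_{(i,j)\in I\times J}$ is summable with sum $(\Sigma_I\mathbf{a})\cdot(\Sigma_J\mathbf{b})$. Evaluations. $J^\star=\bigcup_{n\in\mathbb{N}}J^n$ is the set of finite words over $J$ (including the empty word). A unital ultrafinite summability algebra $A$ has evaluations if there is a closed ideal $\mathfrak{m}$ of $A$ with $A=k1_A+\mathfrak{m}$ such that for every set $J$ and every summable family $\mathbf{f}\colon J\to\mathfrak{m}$, the family $(\mathbf{f}(\theta_1)\cdots\mathbf{f}(\theta_n))_{(\theta_1,\dots,\theta_n)\in J^\star}$ is summable in $A$ (empty product $=1_A$). A unital algebra $A$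 is local if it has a unique maximal left ideal; equivalently, it has a unique maximal right ideal; equivalently, the set of non-units is an ideal. In this case the maximal left and right ideals both equal the set of non-units. *)

theory Defs
  imports Complex_Main "HOL-Library.Disjoint_Sets"
begin

text \<open>
  Index sets are the subsets of an arbitrary infinite type \<open>'i\<close>, which takes the place of the class
  of all sets. Subsets of an infinite type are, up to bijection, stable under finite disjoint
  unions, products, sums of finite sets, and finite words. Restricting a structure given on all
  sets to the subsets of \<open>'i\<close> yields a structure in the sense below, for every infinite \<open>'i\<close>.

  \<open>sdom I v\<close> means that the family \<open>v\<close>, restricted to \<open>I\<close>, is summable, and \<open>ssum I v\<close> is then
  its sum. By \<open>family_cong\<close> only the values of \<open>v\<close> on \<open>I\<close> matter, so that \<open>sdom I\<close> amounts to a
  subset of the space of maps from \<open>I\<close> to \<open>V\<close>. Values of \<open>ssum\<close> at non-summable families are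
  irrelevant.
\<close>

locale summability_space = vector_space scale
  for scale :: "'k::field \<Rightarrow> 'v::ab_group_add \<Rightarrow> 'v" +
  fixes sdom :: "'i set \<Rightarrow> ('i \<Rightarrow> 'v) \<Rightarrow> bool"
    and ssum :: "'i set \<Rightarrow> ('i \<Rightarrow> 'v) \<Rightarrow> 'v"
  assumes infinite_index: "infinite (UNIV :: 'i set)"
    and family_cong:
      "(\<And>i. i \<in> I \<Longrightarrow> v i = w i) \<Longrightarrow> sdom I v \<Longrightarrow> sdom I w \<and> ssum I v = ssum I w"
    and linear_add:
      "sdom I v \<Longrightarrow> sdom I w \<Longrightarrow>
        sdom I (\<lambda>i. v i + w i) \<and> ssum I (\<lambda>i. v i + w i) = ssum I v + ssum I w"
    and linear_scale:
      "sdom I v \<Longrightarrow> sdom I (\<lambda>i. scale c (v i)) \<and> ssum I (\<lambda>i. scale c (v i)) = scale c (ssum I v)"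
    and SS1:
      "finite {i \<in> I. v i \<noteq> 0} \<Longrightarrow> sdom I v \<and> ssum I v = (\<Sum>i \<in> {i \<in> I. v i \<noteq> 0}. v i)"
    and SS2:
      "bij_betw \<phi> I J \<Longrightarrow> sdom J v \<Longrightarrow> sdom I (v \<circ> \<phi>) \<and> ssum I (v \<circ> \<phi>) = ssum J v"
    and SS3:
      "disjoint_family_on P J \<Longrightarrow> I = (\<Union>j\<in>J. P j) \<Longrightarrow> sdom I v \<Longrightarrow>
        (\<forall>j\<in>J. sdom (P j) v) \<and> sdom J (\<lambda>j. ssum (P j) v) \<and>
        ssum I v = ssum J (\<lambda>j. ssum (P j) v)"
    and SS4:
      "I1 \<inter> I2 = {} \<Longrightarrow> sdom I1 v \<Longrightarrow> sdom I2 w \<Longrightarrow>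
        sdom (I1 \<union> I2) (\<lambda>i. if i \<in> I1 then v i else w i)"
begin

text \<open>
  Families over index sets \<open>K\<close> in other types (pairs, words) are summed after reindexing by a
  subset of \<open>'i\<close>. By SS2 the choice of the reindexing is immaterial.
\<close>

definition fam_sums_to :: "'j set \<Rightarrow> ('j \<Rightarrow> 'v) \<Rightarrow> 'v \<Rightarrow> bool" where
  "fam_sums_to K v s \<longleftrightarrow> (\<exists>I \<phi>. bij_betw \<phi> I K \<and> sdom I (v \<circ> \<phi>) \<and> ssum I (v \<circ> \<phi>) = s)"

definition fam_summable :: "'j set \<Rightarrow> ('j \<Rightarrow> 'v) \<Rightarrow> bool" where
  "fam_summable K v \<longleftrightarrow> (\<exists>s. fam_sums_to K v s)"

lemma fam_sums_to_iff:
  assumes "bij_betw \<phi> I K"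
  shows "fam_sums_to K v s \<longleftrightarrow> sdom I (v \<circ> \<phi>) \<and> ssum I (v \<circ> \<phi>) = s"
proof
  assume "fam_sums_to K v s"
  then obtain I' \<phi>' where *: "bij_betw \<phi>' I' K" "sdom I' (v \<circ> \<phi>')" "ssum I' (v \<circ> \<phi>') = s"
    unfolding fam_sums_to_def by blast
  define \<psi> where "\<psi> = inv_into I' \<phi>' \<circ> \<phi>"
  have "bij_betw \<psi> I I'"
    unfolding \<psi>_def using assms bij_betw_inv_into[OF *(1)] by (rule bij_betw_trans)
  from SS2[OF this *(2)] *(3)
  have s: "sdom I (v \<circ> \<phi>' \<circ> \<psi>)" "ssum I (v \<circ> \<phi>' \<circ> \<psi>) = s" by auto
  have "(v \<circ> \<phi>' \<circ> \<psi>) i = (v \<circ> \<phi>) i" if "i \<in> I" for i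
    using that assms bij_betw_inv_into_right[OF *(1)] by (simp add: \<psi>_def bij_betwE)
  from family_cong[OF this s(1)] s(2) show "sdom I (v \<circ> \<phi>) \<and> ssum I (v \<circ> \<phi>) = s" by metis
qed (use assms in \<open>auto simp: fam_sums_to_def\<close>)

lemma fam_sums_to_index_type: "fam_sums_to I v s \<longleftrightarrow> sdom I v \<and> ssum I v = s"
  using fam_sums_to_iff[OF bij_betw_id] by simp

lemma fam_summable_index_type: "fam_summable I v \<longleftrightarrow> sdom I v"
  by (simp add: fam_summable_def fam_sums_to_index_type)

definition closed_subspace :: "'v set \<Rightarrow> bool" where
  "closed_subspace W \<longleftrightarrow> subspace W \<and> (\<forall>I v. sdom I v \<and> v ` I \<subseteq> W \<longrightarrow> ssum I v \<in> W)"

end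

locale ultrafinite_summability_space = summability_space scale sdom ssum
  for scale :: "'k::field \<Rightarrow> 'v::ab_group_add \<Rightarrow> 'v"
    and sdom :: "'i set \<Rightarrow> ('i \<Rightarrow> 'v) \<Rightarrow> bool"
    and ssum :: "'i set \<Rightarrow> ('i \<Rightarrow> 'v) \<Rightarrow> 'v" +
  assumes UF:
    "\<And>I v (X :: 'i \<Rightarrow> 'i set) f. sdom I v \<Longrightarrow> (\<And>i. i \<in> I \<Longrightarrow> finite (X i)) \<Longrightarrow>
      fam_summable (Sigma I X) (\<lambda>(i, x). scale (f i x) (v i))"

locale algebra_over = vector_space scale
  for scale :: "'k::field \<Rightarrow> 'a::ring \<Rightarrow> 'a" +
  assumes scale_mult_left: "scale c x * y = scale c (x * y)"
    and scale_mult_right: "x * scale c y = scale c (x * y)"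
begin

definition left_ideal :: "'a set \<Rightarrow> bool" where
  "left_ideal L \<longleftrightarrow> subspace L \<and> (\<forall>a. \<forall>x\<in>L. a * x \<in> L)"

definition right_ideal :: "'a set \<Rightarrow> bool" where
  "right_ideal R \<longleftrightarrow> subspace R \<and> (\<forall>a. \<forall>x\<in>R. x * a \<in> R)"

definition two_sided_ideal :: "'a set \<Rightarrow> bool" where
  "two_sided_ideal M \<longleftrightarrow> left_ideal M \<and> right_ideal M"

definition maximal_left_ideal :: "'a set \<Rightarrow> bool" where
  "maximal_left_ideal L \<longleftrightarrow>
    left_ideal L \<and> L \<noteq> UNIV \<and> (\<forall>L'. left_ideal L' \<and> L \<subseteq> L' \<longrightarrow> L' = L \<or> L' = UNIV)"

definition maximal_right_ideal :: "'a set \<Rightarrow> bool" where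
  "maximal_right_ideal R \<longleftrightarrow>
    right_ideal R \<and> R \<noteq> UNIV \<and> (\<forall>R'. right_ideal R' \<and> R \<subseteq> R' \<longrightarrow> R' = R \<or> R' = UNIV)"

end

text \<open>The class \<open>ring_1\<close> includes \<open>0 \<noteq> 1\<close>, so the unital algebras below are nonzero.\<close>

locale unital_algebra_over = algebra_over scale
  for scale :: "'k::field \<Rightarrow> 'a::ring_1 \<Rightarrow> 'a"
begin

definition local_algebra :: bool where
  "local_algebra \<longleftrightarrow> (\<exists>!L. maximal_left_ideal L)"

definition local_algebra_with_maximal_ideal :: "'a set \<Rightarrow> bool" where
  "local_algebra_with_maximal_ideal M \<longleftrightarrow>
    local_algebra \<and> maximal_left_ideal M \<and> maximal_right_ideal M"

end

locale summability_algebra = algebra_over scale + summability_space scale sdom ssum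
  for scale :: "'k::field \<Rightarrow> 'a::ring \<Rightarrow> 'a"
    and sdom :: "'i set \<Rightarrow> ('i \<Rightarrow> 'a) \<Rightarrow> bool"
    and ssum :: "'i set \<Rightarrow> ('i \<Rightarrow> 'a) \<Rightarrow> 'a" +
  assumes summable_mult:
    "sdom I a \<Longrightarrow> sdom J b \<Longrightarrow> fam_sums_to (I \<times> J) (\<lambda>(i, j). a i * b j) (ssum I a * ssum J b)"
begin

definition closed_ideal :: "'a set \<Rightarrow> bool" where
  "closed_ideal M \<longleftrightarrow> two_sided_ideal M \<and> closed_subspace M"

end

locale unital_ultrafinite_summability_algebra =
  unital_algebra_over scale + summability_algebra scale sdom ssum +
  ultrafinite_summability_space scale sdom ssum
  for scale :: "'k::field \<Rightarrow> 'a::ring_1 \<Rightarrow> 'a"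
    and sdom :: "'i set \<Rightarrow> ('i \<Rightarrow> 'a) \<Rightarrow> bool"
    and ssum :: "'i set \<Rightarrow> ('i \<Rightarrow> 'a) \<Rightarrow> 'a"
begin

text \<open>\<open>lists J\<close> is the set of finite words over \<open>J\<close>, and \<open>prod_list [] = 1\<close>.\<close>

definition has_evaluations_with :: "'a set \<Rightarrow> bool" where
  "has_evaluations_with M \<longleftrightarrow>
    closed_ideal M \<and> (\<forall>a. \<exists>c. \<exists>x\<in>M. a = scale c 1 + x) \<and>
    (\<forall>J f. sdom J f \<and> f ` J \<subseteq> M \<longrightarrow> fam_summable (lists J) (\<lambda>\<theta>. prod_list (map f \<theta>)))"

definition has_evaluations :: bool where
  "has_evaluations \<longleftrightarrow> (\<exists>M. has_evaluations_with M)"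

end

end

theory Submission
  imports Defs
begin

text \<open>
  Everything rests on the geometric series. For \<open>x \<in> \<mm>\<close>, evaluating at the family with the single
  member \<open>x\<close> shows that the powers of \<open>x\<close> are summable, say with sum \<open>s\<close>. Splitting off the
  term \<open>1\<close> and shifting gives \<open>s = 1 + x s = 1 + s x\<close> (\<open>geometric_series\<close>). This identity has two
  consequences. It cannot hold for \<open>x = 1\<close>, where it would say \<open>s = 1 + s\<close>; hence \<open>\<mm>\<close> is proper, and
  then maximal on both sides because its codimension is one. And it makes \<open>1 - x\<close> a unit with inverse
  \<open>s\<close>, so that every \<open>c 1 + x\<close> with \<open>c \<noteq> 0\<close> is a unit. Thus an element outside \<open>\<mm>\<close> cannot lie in
  a proper left ideal, and \<open>\<mm>\<close> is the only maximal left ideal.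
\<close>

context summability_space
begin

lemma ssum_disjoint_union:
  assumes "I1 \<inter> I2 = {}" and "sdom (I1 \<union> I2) v"
  shows "sdom I1 v" and "sdom I2 v" and "ssum (I1 \<union> I2) v = ssum I1 v + ssum I2 v"
proof -
  \<comment> \<open>The two blocks have to be labelled by elements of the index type.\<close>
  fix p :: 'i
  obtain q :: 'i where "q \<noteq> p"
    using ex_new_if_finite[OF infinite_index, of "{p}"] by auto
  define P where "P j = (if j = p then I1 else I2)" for j
  define u where "u j = ssum (P j) v" for j
  have disj: "disjoint_family_on P {p, q}"
    using assms(1) by (auto simp: disjoint_family_on_def P_def)
  have union: "I1 \<union> I2 = (\<Union>j\<in>{p, q}. P j)"
    using \<open>q \<noteq> p\<close> by (auto simp: P_def)
  note * = SS3[OF disj union assms(2)]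
  from * have "sdom (P p) v" "sdom (P q) v" by auto
  then show "sdom I1 v" "sdom I2 v"
    using \<open>q \<noteq> p\<close> by (auto simp: P_def)
  have "ssum (I1 \<union> I2) v = ssum {p, q} u"
    using * unfolding u_def by blast
  also have "\<dots> = (\<Sum>i \<in> {i \<in> {p, q}. u i \<noteq> 0}. u i)"
    using SS1[of "{p, q}" u] by simp
  also have "\<dots> = (\<Sum>i \<in> {p, q}. u i)"
    by (rule sum.mono_neutral_left) auto
  also have "\<dots> = ssum I1 v + ssum I2 v"
    using \<open>q \<noteq> p\<close> by (simp add: u_def P_def)
  finally show "ssum (I1 \<union> I2) v = ssum I1 v + ssum I2 v" .
qed

lemma sdom_singleton: "sdom {i} v" and ssum_singleton: "ssum {i} v = v i"
proof -
  have fin: "finite {j \<in> {i}. v j \<noteq> 0}" by simp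
  from SS1[OF fin] show "sdom {i} v" by blast
  have "ssum {i} v = (\<Sum>j \<in> {j \<in> {i}. v j \<noteq> 0}. v j)" using SS1[OF fin] by blast
  also have "\<dots> = (\<Sum>j \<in> {i}. v j)" by (rule sum.mono_neutral_left) auto
  finally show "ssum {i} v = v i" by simp
qed

end

context summability_algebra
begin

lemma ssum_mult_left:
  assumes "sdom I v"
  shows "ssum I (\<lambda>i. x * v i) = x * ssum I v"
proof -
  fix p :: 'i
  have "fam_sums_to ({p} \<times> I) (\<lambda>(j, i). x * v i) (x * ssum I v)"
    using summable_mult[OF sdom_singleton assms, of p "\<lambda>_. x"] by (simp add: ssum_singleton)
  moreover have "bij_betw (Pair p) I ({p} \<times> I)"
    by (auto simp: bij_betw_def inj_on_def)
  ultimately show ?thesis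
    by (auto simp: fam_sums_to_iff comp_def)
qed

lemma ssum_mult_right:
  assumes "sdom I v"
  shows "ssum I (\<lambda>i. v i * x) = ssum I v * x"
proof -
  fix p :: 'i
  have "fam_sums_to (I \<times> {p}) (\<lambda>(i, j). v i * x) (ssum I v * x)"
    using summable_mult[OF assms sdom_singleton, of p "\<lambda>_. x"] by (simp add: ssum_singleton)
  moreover have "bij_betw (\<lambda>i. (i, p)) I (I \<times> {p})"
    by (auto simp: bij_betw_def inj_on_def)
  ultimately show ?thesis
    by (auto simp: fam_sums_to_iff comp_def)
qed

end

context unital_algebra_over
begin

lemma maximal_left_ideal_of_codimension_one:
  assumes M: "left_ideal M" and one: "1 \<notin> M"
    and codim: "\<And>a. \<exists>c. \<exists>x\<in>M. a = scale c 1 + x"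
  shows "maximal_left_ideal M"
  unfolding maximal_left_ideal_def
proof (intro conjI allI impI)
  show "left_ideal M" by fact
  show "M \<noteq> UNIV" using one by auto
  fix L assume "left_ideal L \<and> M \<subseteq> L"
  then have L: "subspace L" "\<And>a x. x \<in> L \<Longrightarrow> a * x \<in> L" "M \<subseteq> L"
    by (auto simp: left_ideal_def)
  show "L = M \<or> L = UNIV"
  proof (rule disjCI)
    assume "L \<noteq> UNIV"
    have "a \<in> M" if "a \<in> L" for a
    proof -
      obtain c x where a: "x \<in> M" "a = scale c 1 + x" using codim by blast
      have "scale c 1 \<in> L" using subspace_diff[OF L(1) that, of x] a L(3) by auto
      then have "scale (inverse c) (scale c 1) \<in> L" by (rule subspace_scale[OF L(1)])
      moreover have "1 \<notin> L" using L(2)[of 1] \<open>L \<noteq> UNIV\<close> by auto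
      ultimately have "c = 0" by (cases "c = 0") auto
      with a show ?thesis by simp
    qed
    with L(3) show "L = M" by blast
  qed
qed

lemma maximal_right_ideal_of_codimension_one:
  assumes M: "right_ideal M" and one: "1 \<notin> M"
    and codim: "\<And>a. \<exists>c. \<exists>x\<in>M. a = scale c 1 + x"
  shows "maximal_right_ideal M"
  unfolding maximal_right_ideal_def
proof (intro conjI allI impI)
  show "right_ideal M" by fact
  show "M \<noteq> UNIV" using one by auto
  fix R assume "right_ideal R \<and> M \<subseteq> R"
  then have R: "subspace R" "\<And>a x. x \<in> R \<Longrightarrow> x * a \<in> R" "M \<subseteq> R"
    by (auto simp: right_ideal_def)
  show "R = M \<or> R = UNIV"
  proof (rule disjCI)
    assume "R \<noteq> UNIV"
    have "a \<in> M" if "a \<in> R" for a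
    proof -
      obtain c x where a: "x \<in> M" "a = scale c 1 + x" using codim by blast
      have "scale c 1 \<in> R" using subspace_diff[OF R(1) that, of x] a R(3) by auto
      then have "scale (inverse c) (scale c 1) \<in> R" by (rule subspace_scale[OF R(1)])
      moreover have "1 \<notin> R" using R(2)[of 1] \<open>R \<noteq> UNIV\<close> by auto
      ultimately have "c = 0" by (cases "c = 0") auto
      with a show ?thesis by simp
    qed
    with R(3) show "R = M" by blast
  qed
qed

text \<open>
  A proper left ideal contains no left invertible element, whereas any \<open>c 1 + x\<close> with \<open>c \<noteq> 0\<close> is a
  scalar multiple of some \<open>1 - y\<close> with \<open>y \<in> M\<close>.
\<close>

lemma proper_left_ideal_subset:
  assumes M: "subspace M"
    and codim: "\<And>a. \<exists>c. \<exists>x\<in>M. a = scale c 1 + x"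
    and left_inverse: "\<And>x. x \<in> M \<Longrightarrow> \<exists>s. s * (1 - x) = 1"
    and L: "left_ideal L" "L \<noteq> UNIV"
  shows "L \<subseteq> M"
proof
  fix a assume "a \<in> L"
  obtain c x where a: "x \<in> M" "a = scale c 1 + x" using codim by blast
  have "c = 0"
  proof (rule ccontr)
    assume "c \<noteq> 0"
    define y where "y = scale (- inverse c) x"
    have "y \<in> M" unfolding y_def by (rule subspace_scale[OF M a(1)])
    then obtain s where s: "s * (1 - y) = 1" using left_inverse by blast
    have "scale (inverse c) a = 1 - y"
      using \<open>c \<noteq> 0\<close> by (simp add: a(2) y_def scale_right_distrib)
    then have "1 - y \<in> L"
      using L(1) \<open>a \<in> L\<close> subspace_scale by (metis left_ideal_def)
    then have "b * (s * (1 - y)) \<in> L" for b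
      using L(1) by (simp add: left_ideal_def)
    with s L(2) show False by auto
  qed
  with a show "a \<in> M" by simp
qed

end

context unital_ultrafinite_summability_algebra
begin

text \<open>
  The words over a one-element alphabet correspond to the exponents \<open>n\<close>, and prefixing a letter is
  the bijection onto the non-empty words that turns the family of powers of \<open>x\<close> into its tail.
\<close>

lemma geometric_series:
  assumes M: "has_evaluations_with M" and x: "x \<in> M"
  shows "\<exists>s. s = 1 + x * s \<and> s = 1 + s * x"
proof -
  fix p :: 'i
  have "fam_summable (lists {p}) (\<lambda>\<theta>. prod_list (map (\<lambda>_. x) \<theta>))"
    using M sdom_singleton[of p "\<lambda>_. x"] x unfolding has_evaluations_with_def by blast
  then obtain I \<phi> where \<phi>: "bij_betw \<phi> I (lists {p})"
    and dom: "sdom I ((\<lambda>\<theta>. prod_list (map (\<lambda>_. x) \<theta>)) \<circ> \<phi>)"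
    unfolding fam_summable_def fam_sums_to_def by blast
  define v where "v i = x ^ length (\<phi> i)" for i
  define s where "s = ssum I v"
  have v: "sdom I v"
    using dom by (simp add: v_def[abs_def] comp_def map_replicate_const)
  define \<psi> where "\<psi> = inv_into I \<phi>"
  have \<psi>: "bij_betw \<psi> (lists {p}) I"
    unfolding \<psi>_def by (rule bij_betw_inv_into[OF \<phi>])
  have \<phi>\<psi>: "\<phi> (\<psi> w) = w" if "w \<in> lists {p}" for w
    unfolding \<psi>_def using bij_betw_inv_into_right[OF \<phi> that] .
  define i0 where "i0 = \<psi> []"
  have i0: "i0 \<in> I" "v i0 = 1"
    using \<psi> by (auto simp: i0_def v_def \<phi>\<psi> bij_betwE)
  define \<sigma> where "\<sigma> = \<psi> \<circ> (Cons p \<circ> \<phi>)"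
  have "bij_betw (Cons p) (lists {p}) (lists {p} - {[]})"
  proof (rule bij_betw_byWitness[where f' = tl])
    show "\<forall>w \<in> lists {p} - {[]}. p # tl w = w"
      by (metis DiffE hd_in_set in_listsD insertI1 list.collapse singletonD)
  qed (auto dest: list.set_sel(2))
  moreover have "bij_betw \<psi> (lists {p} - {[]}) (I - {i0})"
    unfolding i0_def using bij_betw_DiffI[OF \<psi>, of "{[]}" "{\<psi> []}"] \<psi>
    by (auto simp: bij_betwE)
  ultimately have \<sigma>: "bij_betw \<sigma> I (I - {i0})"
    unfolding \<sigma>_def using \<phi> by (blast intro: bij_betw_trans)
  have shift: "v (\<sigma> i) = x * v i" if "i \<in> I" for i
    using bij_betwE[OF \<phi>] that by (simp add: v_def \<sigma>_def \<phi>\<psi>)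
  have split: "{i0} \<union> (I - {i0}) = I" using i0 by auto
  have tail: "sdom (I - {i0}) v" "s = 1 + ssum (I - {i0}) v"
    using ssum_disjoint_union[of "{i0}" "I - {i0}" v] v i0
    by (simp_all add: split s_def ssum_singleton insert_absorb)
  note \<sigma>v = SS2[OF \<sigma> tail(1)]
  have "ssum I (v \<circ> \<sigma>) = ssum I (\<lambda>i. x * v i)"
    using family_cong[of I "v \<circ> \<sigma>" "\<lambda>i. x * v i"] \<sigma>v shift by simp
  then have left: "ssum (I - {i0}) v = x * s"
    using \<sigma>v ssum_mult_left[OF v] by (simp add: s_def)
  have "ssum I (v \<circ> \<sigma>) = ssum I (\<lambda>i. v i * x)"
    using family_cong[of I "v \<circ> \<sigma>" "\<lambda>i. v i * x"] \<sigma>v shift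
    by (simp add: v_def power_commutes)
  then have right: "ssum (I - {i0}) v = s * x"
    using \<sigma>v ssum_mult_right[OF v] by (simp add: s_def)
  from tail(2) left right show ?thesis by metis
qed

lemma local_algebra_if_evaluations:
  assumes M: "has_evaluations_with M"
  shows "local_algebra_with_maximal_ideal M"
proof -
  have ideals: "left_ideal M" "right_ideal M" and subspace: "subspace M"
    and codim: "\<And>a. \<exists>c. \<exists>x\<in>M. a = scale c 1 + x"
    using M by (auto simp: has_evaluations_with_def closed_ideal_def two_sided_ideal_def
        left_ideal_def)
  have one: "1 \<notin> M"
    using geometric_series[OF M, of 1] by auto
  have left_inverse: "\<exists>s. s * (1 - x) = 1" if x: "x \<in> M" for x
  proof -
    obtain s where "s = 1 + s * x" using geometric_series[OF M x] by blast
    then have "s * (1 - x) = 1" by (simp add: right_diff_distrib diff_eq_eq)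
    then show ?thesis ..
  qed
  have maximal: "maximal_left_ideal M"
    using ideals(1) one codim by (rule maximal_left_ideal_of_codimension_one)
  have "L = M" if L: "maximal_left_ideal L" for L
  proof -
    have "L \<subseteq> M"
      using proper_left_ideal_subset[OF subspace codim left_inverse] L
      by (simp add: maximal_left_ideal_def)
    then show ?thesis
      using L maximal unfolding maximal_left_ideal_def by metis
  qed
  with maximal have "local_algebra"
    unfolding local_algebra_def by blast
  then show ?thesis
    using maximal maximal_right_ideal_of_codimension_one[OF ideals(2) one codim]
    by (simp add: local_algebra_with_maximal_ideal_def)
qed

end

theorem proposition1p44:
  fixes scale :: "'k::field \<Rightarrow> 'a::ring_1 \<Rightarrow> 'a"
    and sdom :: "'i set \<Rightarrow> ('i \<Rightarrow> 'a) \<Rightarrow> bool"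
    and ssum :: "'i set \<Rightarrow> ('i \<Rightarrow> 'a) \<Rightarrow> 'a"
    and \<mm> :: "'a set"
  assumes "unital_ultrafinite_summability_algebra scale sdom ssum"
    and "unital_ultrafinite_summability_algebra.has_evaluations_with scale sdom ssum \<mm>"
  shows "unital_algebra_over.local_algebra_with_maximal_ideal scale \<mm>"
  using assms by (rule unital_ultrafinite_summability_algebra.local_algebra_if_evaluations)

end
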